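(* Let $\delta_{\mathcal{M}}$ be the maximum degree of the nodes in $\mathcal{M}$ on the flow graph constructed for the non-phasor test, and let $T_{\max}=2(\delta_{\mathcal{M}}-1)$. Then a probing setup $(\mathcal{M},\mathcal{O})$ with non-phasor data cannot turn into successful beyond $T_{\max}$: if the setup is not deemed successful for $T=T_{\max}$, then it is not deemed successful for any even integer $T>T_{\max}$.
   Context: A feeder is a finite graph $\mathcal{G}$ whose node set is partitioned into metered (probed) buses $\mathcal{M}$ and non-metered buses $\mathcal{O}$, with $O=|\mathcal{O}|$; the pair $(\mathcal{M},\mathcal{O})$ is called a probing setup. The number $T$ of probing slots is assumed even. Flow graph for the non-phasor test with $T$ probing slots: its nodes are a source $n_s$, the nodes of $\mathcal{O}$, the nodes of $\mathcal{M}$, and a destination $n_d$. The source $n_s$ is connected to every node of $\mathcal{O}$ by an edge of capacity $1$; each node of $\mathcal{O}$ is connected to each node of $\mathcal{M}$ adjacent to it in $\mathcal{G}$ by an edge of capacity $1$ (flow directed from $\mathcal{O}$ to $\mathcal{M}$); and every node of $\mathcal{M}$ is connected to $n_d$ by an edge of capacity $T/2$. The degree of $m\in\mathcal{M}$ on this graph counts all its incident edges, including the edge to $n_d$ (it does not depend on $T$). The setup with non-phasor data is deemed successful for $T$ if the maximum $n_s$--$n_d$ flow on this graph equals $O$. *)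

theory Defs
  imports Complex_Main "Graph_Theory.Digraph"
begin

text \<open>Flows in capacitated digraphs\<close>

definition is_flow ::
    "('v, 'e) pre_digraph \<Rightarrow> ('e \<Rightarrow> real) \<Rightarrow> 'v \<Rightarrow> 'v \<Rightarrow> ('e \<Rightarrow> real) \<Rightarrow> bool" where
  "is_flow N c s t f \<longleftrightarrow>
     (\<forall>e \<in> arcs N. 0 \<le> f e \<and> f e \<le> c e) \<and>
     (\<forall>v \<in> verts N - {s, t}. (\<Sum>e \<in> in_arcs N v. f e) = (\<Sum>e \<in> out_arcs N v. f e))"

definition flow_value :: "('v, 'e) pre_digraph \<Rightarrow> 'v \<Rightarrow> ('e \<Rightarrow> real) \<Rightarrow> real" where
  "flow_value N s f = (\<Sum>e \<in> out_arcs N s. f e) - (\<Sum>e \<in> in_arcs N s. f e)"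

definition is_max_flow ::
    "('v, 'e) pre_digraph \<Rightarrow> ('e \<Rightarrow> real) \<Rightarrow> 'v \<Rightarrow> 'v \<Rightarrow> ('e \<Rightarrow> real) \<Rightarrow> bool" where
  "is_max_flow N c s t = is_arg_max (flow_value N s) (is_flow N c s t)"

definition degree :: "('v, 'e) pre_digraph \<Rightarrow> 'v \<Rightarrow> nat" where
  "degree N v = in_degree N v + out_degree N v"

text \<open>
  Probing setups. The feeder is a finite undirected graph, modelled as a finite symmetric
  digraph; only adjacency matters below, so loops and parallel arcs need not be excluded.
\<close>

definition probing_setup :: "('a, 'b) pre_digraph \<Rightarrow> 'a set \<Rightarrow> 'a set \<Rightarrow> bool" where
  "probing_setup G M Ob \<longleftrightarrow> pseudo_graph G \<and> M \<union> Ob = verts G \<and> M \<inter> Ob = {}"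

datatype 'a flow_node = Source | Bus 'a | Dest

definition flow_graph ::
    "('a, 'b) pre_digraph \<Rightarrow> 'a set \<Rightarrow> 'a set \<Rightarrow>
     ('a flow_node, 'a flow_node \<times> 'a flow_node) pre_digraph" where
  "flow_graph G M Ob =
     \<lparr> verts = {Source, Dest} \<union> Bus ` Ob \<union> Bus ` M,
       arcs = {(Source, Bus v) | v. v \<in> Ob}
            \<union> {(Bus v, Bus m) | v m. v \<in> Ob \<and> m \<in> M \<and> v \<rightarrow>\<^bsub>G\<^esub> m}
            \<union> {(Bus m, Dest) | m. m \<in> M},
       tail = fst, head = snd \<rparr>"

definition capacity :: "nat \<Rightarrow> 'a flow_node \<times> 'a flow_node \<Rightarrow> real" where
  "capacity T e = (if snd e = Dest then real T / 2 else 1)"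

definition successful :: "('a, 'b) pre_digraph \<Rightarrow> 'a set \<Rightarrow> 'a set \<Rightarrow> nat \<Rightarrow> bool" where
  "successful G M Ob T \<longleftrightarrow>
     (\<exists>f. is_max_flow (flow_graph G M Ob) (capacity T) Source Dest f \<and>
          flow_value (flow_graph G M Ob) Source f = real (card Ob))"

text \<open>
  The maximum is unspecified when \<open>M\<close> is empty. Otherwise it is at least 1, because of the arc to
  \<open>Dest\<close>, so the subtraction in \<open>T_max\<close> does not truncate.
\<close>

definition max_degree :: "('a, 'b) pre_digraph \<Rightarrow> 'a set \<Rightarrow> 'a set \<Rightarrow> nat" where
  "max_degree G M Ob = Max ((\<lambda>m. degree (flow_graph G M Ob) (Bus m)) ` M)"

definition T_max :: "('a, 'b) pre_digraph \<Rightarrow> 'a set \<Rightarrow> 'a set \<Rightarrow> nat" where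
  "T_max G M Ob = 2 * (max_degree G M Ob - 1)"

end

theory Submission
  imports Defs
begin

text \<open>
  The arc from a metered bus \<open>m\<close> to the destination carries exactly the inflow of \<open>m\<close>, which is at
  most the in-degree of \<open>m\<close>, because the arcs into \<open>m\<close> have capacity 1. The in-degree is the degree
  minus 1, so the capacities of the arcs into the destination do not bind once \<open>T \<ge> T_max\<close>, and all
  such \<open>T\<close> admit the same flows.
\<close>

lemma capacity_mono: "S \<le> T \<Longrightarrow> capacity S e \<le> capacity T e"
  by (simp add: capacity_def)

lemma is_flow_mono:
  assumes "is_flow N c s t f" and "\<And>e. e \<in> arcs N \<Longrightarrow> c e \<le> c' e"
  shows "is_flow N c' s t f"
  using assms by (fastforce simp: is_flow_def)

text \<open>Arcs between buses start in \<open>Ob\<close>, so disjointness leaves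
  \<open>Bus m\<close> only its arc to \<open>Dest\<close>.\<close>

lemma out_arcs_metered:
  assumes "M \<inter> Ob = {}" and "m \<in> M"
  shows "out_arcs (flow_graph G M Ob) (Bus m) = {(Bus m, Dest)}"
  using assms by (auto simp: out_arcs_def flow_graph_def)

lemma flow_to_Dest_le_max_degree:
  assumes probing: "probing_setup G M Ob" and m: "m \<in> M"
    and flow: "is_flow (flow_graph G M Ob) (capacity T) Source Dest f"
  shows "f (Bus m, Dest) \<le> real (max_degree G M Ob - 1)"
proof -
  let ?N = "flow_graph G M Ob"
  have disj: "M \<inter> Ob = {}" and "finite (verts G)" and "M \<subseteq> verts G"
    using probing
    by (auto simp: probing_setup_def pseudo_graph_def dest: fin_digraph.finite_verts)
  then have "finite M"
    by (auto intro: finite_subset)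
  then have "degree ?N (Bus m) \<le> max_degree G M Ob"
    using m by (simp add: max_degree_def)
  \<comment> \<open>The single arc to \<open>Dest\<close> accounts for the 1 subtracted.\<close>
  then have deg: "in_degree ?N (Bus m) \<le> max_degree G M Ob - 1"
    by (simp add: degree_def out_degree_def out_arcs_metered[OF disj m])
  have "Bus m \<in> verts ?N - {Source, Dest}"
    using m by (auto simp: flow_graph_def)
  then have "f (Bus m, Dest) = (\<Sum>e\<in>in_arcs ?N (Bus m). f e)"
    \<comment> \<open>Conservation at \<open>Bus m\<close>, whose outflow is a single term.\<close>
    using flow by (simp add: is_flow_def out_arcs_metered[OF disj m])
  also have "\<dots> \<le> real (in_degree ?N (Bus m)) * 1"
    unfolding in_degree_def
  proof (rule sum_bounded_above)
    fix e assume "e \<in> in_arcs ?N (Bus m)"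
    then have "e \<in> arcs ?N" and "snd e = Bus m"
      by (auto simp: in_arcs_def flow_graph_def)
    then show "f e \<le> 1"
      using flow by (auto simp: is_flow_def capacity_def)
  qed
  finally show ?thesis
    using deg by simp
qed

text \<open>The capacity of an arc into \<open>Dest\<close> at \<open>T_max\<close> is
  \<open>T_max / 2\<close>, exactly the bound just proved for every \<open>T\<close>; the other
  capacities do not depend on \<open>T\<close>.\<close>

lemma is_flow_T_max:
  assumes probing: "probing_setup G M Ob"
    and flow: "is_flow (flow_graph G M Ob) (capacity T) Source Dest f"
  shows "is_flow (flow_graph G M Ob) (capacity (T_max G M Ob)) Source Dest f"
proof -
  have "f e \<le> capacity (T_max G M Ob) e" if e: "e \<in> arcs (flow_graph G M Ob)" for e
  proof (cases "snd e = Dest")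
    case True
    with e obtain m where "m \<in> M" "e = (Bus m, Dest)"
      by (auto simp: flow_graph_def)
    then show ?thesis
      using flow_to_Dest_le_max_degree[OF probing _ flow] by (simp add: capacity_def T_max_def)
  next
    case False
    then show ?thesis
      using flow e by (auto simp: is_flow_def capacity_def)
  qed
  then show ?thesis
    using flow by (simp add: is_flow_def)
qed

theorem corollary1:
  fixes G :: "('a, 'b) pre_digraph" and M Ob :: "'a set"
  assumes "probing_setup G M Ob"
    and "\<not> successful G M Ob (T_max G M Ob)"
  shows "\<forall>T. even T \<and> T > T_max G M Ob \<longrightarrow> \<not> successful G M Ob T"
proof (intro allI impI)
  fix T assume "even T \<and> T > T_max G M Ob"
  \<comment> \<open>Capacities enter \<open>is_max_flow\<close> only through \<open>is_flow\<close>,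
    so equal sets of flows give the same verdict on success.\<close>
  then have "is_flow (flow_graph G M Ob) (capacity T) Source Dest =
      is_flow (flow_graph G M Ob) (capacity (T_max G M Ob)) Source Dest"
    by (intro ext iffI is_flow_T_max[OF assms(1)])
      (auto intro: is_flow_mono[OF _ capacity_mono])
  then show "\<not> successful G M Ob T"
    using assms(2) by (simp add: successful_def is_max_flow_def)
qed

end
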